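(* $$\zeta(3) = \frac14 \sum_{n=1}^{\infty} (-1)^{n-1}\, \frac{56n^2-32n+5}{(2n-1)^2}\, \frac{1}{\binom{3n}{n}\binom{2n}{n}\, n^3}.$$
   Context: Here $\zeta(3)=\sum_{m=1}^{\infty} \frac{1}{m^3}$ is the value of the Riemann zeta function at $3$, and $\binom{a}{b}$ denotes the usual binomial coefficient. *)

theory Defs
  imports "HOL-Analysis.Analysis"
begin

(* The Dirichlet series of zeta at a natural number s, meant for s \<ge> 2. *)
definition zeta_nat :: "nat \<Rightarrow> real" where
  "zeta_nat s = (\<Sum>m. 1 / real (Suc m) ^ s)"

lemma zeta_nat_sums:
  assumes "s \<ge> 2"
  shows "(\<lambda>m. 1 / real (Suc m) ^ s) sums zeta_nat s"
proof -
  have "summable (\<lambda>m. inverse (real m ^ s))"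
    using inverse_power_summable[OF assms, where 'a = real] by simp
  then have "summable (\<lambda>m. inverse (real (Suc m) ^ s))"
    by (subst summable_Suc_iff)
  then show ?thesis
    unfolding zeta_nat_def by (simp add: divide_inverse summable_sums)
qed

(* Meant for n \<ge> 1; at n = 0 the truncated exponent and the division by 0 are junk. *)
definition zeta3_term :: "nat \<Rightarrow> real" where
  "zeta3_term n =
     (-1) ^ (n - 1)
     * ((56 * real n ^ 2 - 32 * real n + 5) / (2 * real n - 1) ^ 2)
     * (1 / (real ((3 * n) choose n) * real ((2 * n) choose n) * real n ^ 3))"

end

theory Submission
  imports Defs
begin

text \<open>
  The proof is the Wilf-Zeilberger method.  On lattice points \<open>(n, k)\<close> with \<open>n > k\<close> put
  \<open>G(n,k) = (-1)^k k!^2 (n-k-1)! / ((n+k)! n^2)\<close> and, for \<open>n > k + 1\<close>,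
  \<open>F(n,k) = (-1)^k k!^2 (n-k-2)! / (2 (k+1) (n+k)!)\<close>.  They satisfy
  \<open>G(n,k+1) - G(n,k) = F(n+1,k) - F(n,k)\<close>, so weighting the step \<open>(n,k) \<rightarrow> (n+1,k)\<close>
  by \<open>G(n,k)\<close> and the step \<open>(n,k) \<rightarrow> (n,k+1)\<close> by \<open>F(n,k)\<close> makes the total weight of a lattice
  path depend only on its end points.

  Along the axis \<open>k = 0\<close> the weight is the sum of \<open>G(n,0) = 1/n^3\<close>, which is \<open>\<zeta>(3)\<close>.  The
  series of the theorem is the weight of the staircase of slope \<open>1/2\<close> that starts at \<open>(1,0)\<close>
  and repeats two steps in direction \<open>n\<close> followed by one in direction \<open>k\<close>: one period of it,
  from \<open>(2k+1,k)\<close> to \<open>(2k+3,k+1)\<close>, contributes a quarter of one term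
  (\<open>staircase_period\<close>).  To compare the two infinite paths, let \<open>R\<^sub>k\<close> be the weight of the ray
  from \<open>(2k+1,k)\<close> in direction \<open>n\<close>.  Summing the relation between \<open>G\<close> and \<open>F\<close> along a ray shows
  that \<open>R\<^sub>k - R\<^sub>k\<^sub>+\<^sub>1\<close> is the weight of a period (\<open>ray_weight_Suc\<close>); as \<open>R\<^sub>0 = \<zeta>(3)\<close> and
  \<open>R\<^sub>k\<close> tends to \<open>0\<close> (\<open>ray_weight_tendsto_0\<close>), telescoping gives the result.
\<close>

text \<open>
  The weights are indexed by the argument \<open>d\<close> of the factorial in the numerator, which avoids
  truncated subtraction: \<open>wz_G d k\<close> is \<open>G(d+k+1,k)\<close> and \<open>wz_F d k\<close> is \<open>F(d+k+2,k)\<close>.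
\<close>

definition wz_G :: "nat \<Rightarrow> nat \<Rightarrow> real" where
  "wz_G d k = (-1) ^ k * fact k ^ 2 * fact d / (fact (d + 2 * k + 1) * real (d + k + 1) ^ 2)"

definition wz_F :: "nat \<Rightarrow> nat \<Rightarrow> real" where
  "wz_F d k = (-1) ^ k * fact k ^ 2 * fact d / (2 * real (k + 1) * fact (d + 2 * k + 2))"

text \<open>
  With \<open>n = d + k + 2\<close>, the left side is \<open>-G(n,k) n^2 / (n^2 - (k+1)^2)\<close>: the factor \<open>n^2\<close>
  cancels, and the remaining quotient of factorials is a difference in \<open>n\<close>.
\<close>

lemma wz_pair: "wz_G d (Suc k) - wz_G (Suc d) k = wz_F (Suc d) k - wz_F d k"
proof -
  define x y where "x = real d" and "y = real k"
  define f where "f = (fact (d + 2 * k + 2) :: real)"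
  define c where "c = (-1) ^ k * fact k ^ 2 * (fact d :: real)"
  have pos: "x \<ge> 0" "y \<ge> 0" "f > 0"
    by (simp_all add: x_def y_def f_def)
  have "wz_G d (Suc k) = - (c * (y + 1)^2 / ((x + 2 * y + 3) * f * (x + y + 2)^2))"
  proof -
    have "fact (Suc k) ^ 2 = fact k ^ 2 * (y + 1) ^ 2"
      by (simp add: y_def power2_eq_square algebra_simps)
    moreover have "fact (d + 2 * Suc k + 1) = (x + 2 * y + 3) * f"
      using fact_Suc[of "d + 2 * k + 2", where 'a = real]
      by (simp add: x_def y_def f_def numeral_3_eq_3 del: fact_Suc)
    moreover have "real (d + Suc k + 1) = x + y + 2"
      by (simp add: x_def y_def)
    ultimately show ?thesis
      unfolding wz_G_def by (simp add: c_def mult_ac)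
  qed
  moreover have "wz_G (Suc d) k = c * (x + 1) / (f * (x + y + 2)^2)"
    by (simp add: wz_G_def c_def f_def x_def y_def algebra_simps)
  moreover have "wz_F (Suc d) k = c * (x + 1) / (2 * (y + 1) * ((x + 2 * y + 3) * f))"
    by (simp add: wz_F_def c_def f_def x_def y_def algebra_simps)
  moreover have "wz_F d k = c / (2 * (y + 1) * f)"
    by (simp add: wz_F_def c_def f_def y_def algebra_simps)
  moreover have "- (c * (y + 1)^2 / ((x + 2 * y + 3) * f * (x + y + 2)^2)) - c * (x + 1) / (f * (x + y + 2)^2)
      = - (c / ((x + 2 * y + 3) * f))"
  proof -
    have "x + 2 * y + 3 \<noteq> 0" "x + y + 2 \<noteq> 0" "f \<noteq> 0"
      using pos by auto
    then show ?thesis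
      by (simp add: divide_simps) algebra
  qed
  moreover have "c * (x + 1) / (2 * (y + 1) * ((x + 2 * y + 3) * f)) - c / (2 * (y + 1) * f)
      = - (c / ((x + 2 * y + 3) * f))"
  proof -
    have "x + 2 * y + 3 \<noteq> 0" "y + 1 \<noteq> 0" "f \<noteq> 0"
      using pos by auto
    then show ?thesis
      by (simp add: divide_simps) algebra
  qed
  ultimately show ?thesis
    by simp
qed

lemma fact_mult_le_fact_add: "fact a * fact b \<le> (fact (a + b) :: real)"
proof -
  have "fact a * fact b \<le> (fact (a + b) :: nat)"
    by (intro dvd_imp_le fact_fact_dvd_fact) simp
  then have "real (fact a * fact b) \<le> real (fact (a + b))"
    by (rule of_nat_mono)
  then show ?thesis
    by simp
qed

lemma fact_square_mult_le: "fact k ^ 2 * fact d \<le> (fact (d + 2 * k) :: real)"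
proof -
  have "fact k ^ 2 * fact d = fact k * (fact k * fact d :: real)"
    by (simp add: power2_eq_square)
  also have "\<dots> \<le> fact k * fact (k + d)"
    by (intro mult_left_mono fact_mult_le_fact_add) simp
  also have "\<dots> \<le> fact (k + (k + d))"
    by (rule fact_mult_le_fact_add)
  finally show ?thesis
    by (simp add: mult_2 add_ac)
qed

text \<open>
  The bound is a product so that it serves twice: the factor in \<open>m\<close> makes each ray summable,
  and the factor in \<open>k\<close> makes the weights of the rays tend to \<open>0\<close>.
\<close>

lemma abs_wz_G_le: "\<bar>wz_G (k + m) k\<bar> \<le> 1 / real (Suc k) * (1 / real (Suc m) ^ 2)"
proof -
  define d where "d = k + m"
  have "\<bar>wz_G d k\<bar> = fact k ^ 2 * fact d / (fact (d + 2 * k) * (real (d + 2 * k + 1) * real (d + k + 1) ^ 2))"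
    by (simp add: wz_G_def abs_mult power_abs mult_ac)
  also have "\<dots> \<le> fact (d + 2 * k) / (fact (d + 2 * k) * (real (d + 2 * k + 1) * real (d + k + 1) ^ 2))"
    by (intro divide_right_mono fact_square_mult_le) simp
  also have "\<dots> = 1 / (real (d + 2 * k + 1) * real (d + k + 1) ^ 2)"
    by simp
  also have "\<dots> \<le> 1 / (real (Suc k) * real (Suc m) ^ 2)"
    by (intro divide_left_mono mult_mono power_mono) (auto simp: d_def simp del: of_nat_Suc)
  finally show ?thesis
    by (simp add: d_def)
qed

lemma wz_F_tendsto_0: "(\<lambda>d. wz_F d k) \<longlonglongrightarrow> 0"
proof (rule Lim_null_comparison)
  show "\<forall>\<^sub>F d in sequentially. norm (wz_F d k) \<le> 1 / real (Suc d)"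
  proof (intro always_eventually allI)
    fix d
    have "norm (wz_F d k)
        = fact k ^ 2 * fact d / (fact (d + 2 * k) * (real (d + 2 * k + 1) * (real (d + 2 * k + 2) * (2 * real (k + 1)))))"
      by (simp add: wz_F_def abs_mult power_abs mult_ac)
    also have "\<dots> \<le> fact (d + 2 * k) / (fact (d + 2 * k) * (real (d + 2 * k + 1) * (real (d + 2 * k + 2) * (2 * real (k + 1)))))"
      by (intro divide_right_mono fact_square_mult_le) simp
    also have "\<dots> = 1 / (real (d + 2 * k + 1) * (real (d + 2 * k + 2) * (2 * real (k + 1))))"
      by simp
    also have "\<dots> \<le> 1 / (real (Suc d) * (1 * 1))"
      by (intro divide_left_mono mult_mono) auto
    finally show "norm (wz_F d k) \<le> 1 / real (Suc d)"
      by simp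
  qed
  show "(\<lambda>d. 1 / real (Suc d)) \<longlonglongrightarrow> 0"
    using LIMSEQ_inverse_real_of_nat by (simp add: inverse_eq_divide)
qed

definition ray_weight :: "nat \<Rightarrow> real" where
  "ray_weight k = (\<Sum>m. wz_G (k + m) k)"

lemma summable_inverse_squares: "summable (\<lambda>m. 1 / real (Suc m) ^ 2)"
  using zeta_nat_sums[of 2] by (simp add: sums_iff)

lemma summable_ray: "summable (\<lambda>m. wz_G (k + m) k)"
  by (rule summable_comparison_test_ev[OF _ summable_mult[OF summable_inverse_squares]])
     (intro always_eventually allI, simp only: real_norm_def, rule abs_wz_G_le)

lemma ray_weight_tendsto_0: "ray_weight \<longlonglongrightarrow> 0"
proof (rule Lim_null_comparison)
  show "\<forall>\<^sub>F k in sequentially. norm (ray_weight k) \<le> 1 / real (Suc k) * zeta_nat 2"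
  proof (intro always_eventually allI)
    fix k
    have "norm (ray_weight k) \<le> (\<Sum>m. 1 / real (Suc k) * (1 / real (Suc m) ^ 2))"
      unfolding ray_weight_def
      by (rule norm_suminf_le) (simp_all only: real_norm_def abs_wz_G_le summable_mult summable_inverse_squares)
    also have "\<dots> = 1 / real (Suc k) * zeta_nat 2"
      unfolding zeta_nat_def by (rule suminf_mult[OF summable_inverse_squares])
    finally show "norm (ray_weight k) \<le> 1 / real (Suc k) * zeta_nat 2" .
  qed
  have "(\<lambda>k. 1 / real (Suc k)) \<longlonglongrightarrow> 0"
    using LIMSEQ_inverse_real_of_nat by (simp add: inverse_eq_divide)
  then show "(\<lambda>k. 1 / real (Suc k) * zeta_nat 2) \<longlonglongrightarrow> 0"
    by (rule tendsto_mult_left_zero)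
qed

text \<open>
  The ray from \<open>(2k+1,k)\<close> loses its first two steps and is then moved up to level \<open>k + 1\<close>;
  by the relation between \<open>G\<close> and \<open>F\<close> the move costs the weight of the vertical step at its left
  end, since the vertical weights vanish at infinity.
\<close>

lemma ray_weight_Suc:
  "ray_weight (Suc k) = ray_weight k - (wz_G k k + wz_G (Suc k) k + wz_F (Suc k) k)"
proof -
  have "(\<lambda>m. wz_G (k + m) k) sums ray_weight k"
    unfolding ray_weight_def by (rule summable_sums[OF summable_ray])
  then have "(\<lambda>m. wz_G (k + (m + 2)) k) sums (ray_weight k - (\<Sum>i<2. wz_G (k + i) k))"
    by (rule sums_split_initial_segment)
  then have G: "(\<lambda>m. wz_G (k + (m + 2)) k) sums (ray_weight k - (wz_G k k + wz_G (Suc k) k))"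
    by (simp add: numeral_2_eq_2)
  have "(\<lambda>m. wz_F (m + Suc k) k) \<longlonglongrightarrow> 0"
    by (rule LIMSEQ_ignore_initial_segment[OF wz_F_tendsto_0])
  then have "(\<lambda>m. wz_F (Suc m + Suc k) k - wz_F (m + Suc k) k) sums (0 - wz_F (0 + Suc k) k)"
    by (rule telescope_sums)
  from sums_add[OF G this]
  have "(\<lambda>m. wz_G (k + (m + 2)) k + (wz_F (Suc m + Suc k) k - wz_F (m + Suc k) k))
      sums (ray_weight k - (wz_G k k + wz_G (Suc k) k + wz_F (Suc k) k))"
    by (simp add: algebra_simps)
  moreover have "wz_G (k + (m + 2)) k + (wz_F (Suc m + Suc k) k - wz_F (m + Suc k) k)
      = wz_G (Suc k + m) (Suc k)" for m
    using wz_pair[of "Suc k + m" k] by (simp add: add_ac)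
  ultimately show ?thesis
    unfolding ray_weight_def by (simp add: sums_iff)
qed

lemma ray_weight_0: "ray_weight 0 = zeta_nat 3"
proof -
  have "wz_G (0 + m) 0 = 1 / real (Suc m) ^ 3" for m
    by (simp add: wz_G_def power2_eq_square power3_eq_cube del: of_nat_Suc)
  then show ?thesis
    unfolding ray_weight_def zeta_nat_def by simp
qed

lemma binomial_3n_2n: "real ((3 * n) choose n) * real ((2 * n) choose n) = fact (3 * n) / fact n ^ 3"
proof -
  have "real ((3 * n) choose n) = fact (3 * n) / (fact n * fact (2 * n))"
    using binomial_fact[of n "3 * n", where 'a = real] by simp
  moreover have "real ((2 * n) choose n) = fact (2 * n) / (fact n * fact n)"
    using binomial_fact[of n "2 * n", where 'a = real] by simp
  ultimately show ?thesis
    by (simp add: power3_eq_cube)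
qed

lemma staircase_period:
  "wz_G k k + wz_G (Suc k) k + wz_F (Suc k) k = zeta3_term (Suc k) / 4"
proof -
  define y where "y = real k"
  define f where "f = (fact (3 * k + 1) :: real)"
  define c where "c = (-1) ^ k * (fact k ^ 3 :: real)"
  have pos: "y \<ge> 0" "f > 0"
    by (simp_all add: y_def f_def)
  have f2: "fact (3 * k + 2) = (3 * y + 2) * f"
    by (simp add: f_def y_def)
  have f3: "fact (3 * k + 3) = (3 * y + 3) * ((3 * y + 2) * f)"
    using fact_Suc[of "3 * k + 2", where 'a = real] f2
    by (simp add: y_def numeral_3_eq_3 del: fact_Suc)
  have "wz_G k k = c / (f * (2 * y + 1)^2)"
    by (simp add: wz_G_def c_def f_def y_def power2_eq_square power3_eq_cube algebra_simps)
  moreover have "wz_G (Suc k) k = c * (y + 1) / ((3 * y + 2) * f * (2 * y + 2)^2)"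
  proof -
    have "Suc k + 2 * k + 1 = 3 * k + 2" by simp
    then show ?thesis
      unfolding wz_G_def f2[symmetric] by (simp add: c_def y_def power2_eq_square power3_eq_cube mult_ac add_ac del: fact_Suc add: fact_Suc[of k])
  qed
  moreover have "wz_F (Suc k) k = c / (2 * ((3 * y + 3) * ((3 * y + 2) * f)))"
  proof -
    have "Suc k + 2 * k + 2 = 3 * k + 3" by simp
    then have "wz_F (Suc k) k = (-1) ^ k * fact k ^ 2 * ((y + 1) * fact k)
        / (2 * (y + 1) * ((3 * y + 3) * ((3 * y + 2) * f)))"
      unfolding wz_F_def f3[symmetric] by (simp only: fact_Suc[of k]) (simp add: y_def add_ac)
    also have "\<dots> = (y + 1) * c / ((y + 1) * (2 * ((3 * y + 3) * ((3 * y + 2) * f))))"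
      by (simp only: c_def power2_eq_square power3_eq_cube mult_ac)
    also have "\<dots> = c / (2 * ((3 * y + 3) * ((3 * y + 2) * f)))"
      using pos by (intro mult_divide_mult_cancel_left) auto
    finally show ?thesis .
  qed
  moreover have "zeta3_term (Suc k) / 4 =
      c * (56 * (y + 1)^2 - 32 * (y + 1) + 5) / (4 * (2 * y + 1)^2 * ((3 * y + 3) * ((3 * y + 2) * f)))"
  proof -
    have "3 * Suc k = 3 * k + 3" by simp
    then have "real ((3 * Suc k) choose Suc k) * real ((2 * Suc k) choose Suc k) * real (Suc k) ^ 3
        = ((3 * y + 3) * ((3 * y + 2) * f)) / fact k ^ 3"
      unfolding binomial_3n_2n f3[symmetric]
      by (simp add: power_mult_distrib add_ac del: of_nat_Suc fact_Suc add: fact_Suc[of k])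
    then show ?thesis
      unfolding zeta3_term_def by (simp add: c_def y_def add_ac mult_ac)
  qed
  moreover have "c / (f * (2 * y + 1)^2) + c * (y + 1) / ((3 * y + 2) * f * (2 * y + 2)^2)
      + c / (2 * ((3 * y + 3) * ((3 * y + 2) * f)))
      = c * (56 * (y + 1)^2 - 32 * (y + 1) + 5) / (4 * (2 * y + 1)^2 * ((3 * y + 3) * ((3 * y + 2) * f)))"
  proof -
    have "3 * y + 3 \<noteq> 0" "3 * y + 2 \<noteq> 0" "2 * y + 1 \<noteq> 0" "2 * y + 2 \<noteq> 0" "f \<noteq> 0"
      using pos by auto
    then show ?thesis
      by (simp add: divide_simps) algebra
  qed
  ultimately show ?thesis
    by simp
qed

theorem mainTheorem1:
  shows "summable (\<lambda>k. zeta3_term (Suc k)) \<and>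
         zeta_nat 3 = 1 / 4 * (\<Sum>k. zeta3_term (Suc k))"
proof -
  have "(\<lambda>k. ray_weight k - ray_weight (Suc k)) sums (ray_weight 0 - 0)"
    by (rule telescope_sums'[OF ray_weight_tendsto_0])
  then have "(\<lambda>k. zeta3_term (Suc k) / 4) sums zeta_nat 3"
    by (simp add: ray_weight_Suc staircase_period ray_weight_0)
  from sums_mult[OF this, of 4]
  have "(\<lambda>k. zeta3_term (Suc k)) sums (4 * zeta_nat 3)"
    by simp
  then show ?thesis
    by (simp add: sums_iff)
qed

end
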